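(* Consider a max-linear Bayesian network with coefficient matrix $C$ and Kleene star $C^*$. Let $g$ be a directed graph on $V$. Then $g\in\mathfrak{G}$ (that is, $g$ is an impact graph of positive probability) if and only if the following four conditions hold: (a) $g$ is a subgraph of the reachability DAG $\mathcal{D}^*$. (b) $g$ is a galaxy, i.e. a forest of stars. (c) For all pairwise distinct nodes $i,j,k\in V$: if $j\to i$ in $g$ and $c^*_{ij}=c^*_{ik}c^*_{kj}$, then $k\not\to i$ in $g$ and $j\to k$ in $g$. (d) $\lambda(M(g))<1$, where $M(g)$ is the impact exchange matrix of $g$ with respect to $C^*$.
   Context: Max-linear Bayesian network: $V=\{1,\dots,d\}$, $\mathcal{D}=(V,E)$ is a directed acyclic graph (DAG), $C=(c_{ij})\in[0,\infty)^{d\times d}$ with $c_{ij}>0$ if and only if $j\to i\in E$. The innovations $Z_1,\dots,Z_d$ are independent random variables with atom-free distributions having support $(0,\infty)$; the probability space is $\Omega=(0,\infty)^V$ with $Z$ the coordinate vector. $X$ is defined by $X_i=\max\{Z_i,\max_{j\to i\in E}c_{ij}X_j\}$. Kleene star: $C^*=(c^*_{ij})$ has $c^*_{ii}=1$, and for $i\ne j$, $c^*_{ij}$ is the maximum over all directed paths from $j$ to $i$ in $\mathcal{D}$ of the product of the edge weights along the path ($0$ if there is no such path). Then $X_i=\max_{j\in V}c^*_{ij}Z_j$. The reachability DAG $\mathcal{D}^*$ has an edge $j\to i$ ($i\neq j$) if and only if $c^*_{ij}>0$. Impact graphs: $G=G(Z)$ is the random directed graph on $V$ with an edge $j\to i$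 ($i\ne j$) if and only if $X_i=c^*_{ij}Z_j$. $\mathfrak{G}=\mathfrak{G}(C)$ is the set of directed graphs $g$ on $V$ with $\mathbb{P}(G=g)>0$. A tree is a connected DAG in which every node has at most one parent; its root is its unique node without parents; its height is the length of the longest directed path. A forest is a disjoint collection of trees; a star is a tree of height at most one (a single node is allowed); a galaxy is a forest of stars. $R(g)$ is the set of roots of a forest $g$ and $\mathrm{ch}_g(r)$ is the set of children of $r$ in $g$. Impact exchange matrix: for a forest $g$ with root set $R=R(g)$, contained in $\mathcal{D}^*$, $M(g)=(m_{rr'})_{r,r'\in R}$ has $m_{rr}=0$ and, for $r\ne r'$, $m_{rr'}=\max_{i\in \mathrm{ch}_g(r)} c^*_{ir'}/c^*_{ir}$, with $m_{rr'}=0$ if $\mathrm{ch}_g(r)=\emptyset$. For a nonnegative square matrix $A$, $\lambda(A)$ is its maximum cycle mean: the maximum, over directed cycles in the weighted directed graph with an edge $v\to u$ of weight $a_{uv}$ whenever $a_{uv}>0$, of the geometric mean of the edge weights along the cycle; $\lambda(A)=0$ if there are no cycles. *)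

theory Defs
  imports "HOL-Probability.Probability" "Graph_Theory.Digraph_Component"
begin

text \<open>
  Directed graphs are pair digraphs, an arc \<open>(j, i)\<close> standing for the edge \<open>j \<rightarrow> i\<close>.  The vertex set
  \<open>V = {1, \<dots>, d}\<close> is the universe of a finite type \<open>'n\<close>.  Beware that the matrix entry belonging to
  the arc \<open>(j, i)\<close> is \<open>C $ i $ j\<close>.
\<close>

section \<open>Directed acyclic graphs, trees, galaxies\<close>

text \<open>A loop is a cycle in the sense of the graph library, so a DAG is loop-free.\<close>

definition dag :: "'a pair_pre_digraph \<Rightarrow> bool" where
  "dag G \<longleftrightarrow> pair_fin_digraph G \<and> (\<nexists>p. pre_digraph.cycle (with_proj G) p)"

text \<open>
  The constants \<open>tree\<close> and \<open>forest\<close> of the graph library only forbid directed cycles and put no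
  bound on the number of parents; they are not the notions needed here.
  Connectedness is that of the underlying undirected graph.
\<close>

definition rooted_tree :: "'a pair_pre_digraph \<Rightarrow> bool" where
  "rooted_tree G \<longleftrightarrow> dag G \<and> Digraph_Component.connected (with_proj G) \<and>
     (\<forall>v \<in> pverts G. in_degree (with_proj G) v \<le> 1)"

definition height :: "'a pair_pre_digraph \<Rightarrow> nat" where
  "height G = Max {length p |u p v. pre_digraph.apath (with_proj G) u p v}"

definition star :: "'a pair_pre_digraph \<Rightarrow> bool" where
  "star G \<longleftrightarrow> rooted_tree G \<and> height G \<le> 1"

definition disjoint_union_of :: "'a pair_pre_digraph set \<Rightarrow> 'a pair_pre_digraph \<Rightarrow> bool" where
  "disjoint_union_of \<T> g \<longleftrightarrow>
     pairwise (\<lambda>s t. pverts s \<inter> pverts t = {}) \<T> \<and>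
     pverts g = (\<Union>t\<in>\<T>. pverts t) \<and> parcs g = (\<Union>t\<in>\<T>. parcs t)"

definition galaxy :: "'a pair_pre_digraph \<Rightarrow> bool" where
  "galaxy g \<longleftrightarrow> (\<exists>\<T>. (\<forall>t\<in>\<T>. star t) \<and> disjoint_union_of \<T> g)"

text \<open>The roots of the trees of a forest are exactly its vertices without parents.\<close>

definition roots :: "'a pair_pre_digraph \<Rightarrow> 'a set" where
  "roots g = {v \<in> pverts g. \<nexists>u. (u, v) \<in> parcs g}"

definition children :: "'a pair_pre_digraph \<Rightarrow> 'a \<Rightarrow> 'a set" where
  "children g r = {i. (r, i) \<in> parcs g}"

section \<open>Kleene star and impact exchange matrix\<close>

definition kleene_star :: "'n::finite pair_pre_digraph \<Rightarrow> real^'n^'n \<Rightarrow> real^'n^'n" where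
  "kleene_star D C = (\<chi> i j.
     if i = j then 1
     else if \<exists>p. pre_digraph.apath (with_proj D) j p i
       then Max {\<Prod>(v, u)\<leftarrow>p. C $ u $ v |p. pre_digraph.apath (with_proj D) j p i}
     else 0)"

definition reachability_dag :: "real^'n^'n::finite \<Rightarrow> 'n pair_pre_digraph" where
  "reachability_dag Cs = \<lparr>pverts = UNIV, parcs = {(j, i). i \<noteq> j \<and> Cs $ i $ j > 0}\<rparr>"

text \<open>
  The matrix \<open>M(g)\<close> is indexed by \<open>roots g\<close>; it is represented by a function of which only the
  values on \<open>roots g \<times> roots g\<close> matter.
\<close>

definition impact_exchange :: "real^'n^'n::finite \<Rightarrow> 'n pair_pre_digraph \<Rightarrow> 'n \<Rightarrow> 'n \<Rightarrow> real" where
  "impact_exchange Cs g r r' =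
     (if r = r' \<or> children g r = {} then 0
      else Max ((\<lambda>i. Cs $ i $ r' / Cs $ i $ r) ` children g r))"

text \<open>A square matrix with index set \<open>S\<close> is a function \<open>A\<close> restricted to \<open>S \<times> S\<close>.\<close>

definition weight_digraph :: "'a set \<Rightarrow> ('a \<Rightarrow> 'a \<Rightarrow> real) \<Rightarrow> 'a pair_pre_digraph" where
  "weight_digraph S A = \<lparr>pverts = S, parcs = {(v, u). v \<in> S \<and> u \<in> S \<and> A u v > 0}\<rparr>"

definition max_cycle_mean :: "'a set \<Rightarrow> ('a \<Rightarrow> 'a \<Rightarrow> real) \<Rightarrow> real" where
  "max_cycle_mean S A =
     (if \<exists>p. pre_digraph.cycle (with_proj (weight_digraph S A)) p
      then Max {root (length p) (\<Prod>(v, u)\<leftarrow>p. A u v) |p.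
                  pre_digraph.cycle (with_proj (weight_digraph S A)) p}
      else 0)"

section \<open>Max-linear Bayesian networks and impact graphs\<close>

text \<open>Topological support, relative to the space carrying the measure.\<close>

definition msupport :: "'a::topological_space measure \<Rightarrow> 'a set" where
  "msupport \<mu> = {x \<in> space \<mu>. \<forall>U. open U \<and> x \<in> U \<longrightarrow> emeasure \<mu> (U \<inter> space \<mu>) > 0}"

abbreviation pos_borel :: "real measure" where
  "pos_borel \<equiv> restrict_space borel {0<..}"

text \<open>
  The innovations are random variables on an arbitrary probability space with values in
  \<open>(0, \<infinity>)\<close>; the coordinates on \<open>(0, \<infinity>)\<^sup>V\<close> are the canonical instance.  As the graph is acyclic,
  the recursion determines \<open>X\<close> from \<open>Z\<close>.
\<close>

locale max_linear_bayesian_network = prob_space M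
  for M :: "'w measure" +
  fixes D :: "'n::finite pair_pre_digraph"
    and C :: "real^'n^'n"
    and Z X :: "'n \<Rightarrow> 'w \<Rightarrow> real"
  assumes verts_D: "pverts D = UNIV"
    and dag_D: "dag D"
    and C_nonneg: "\<And>i j. C $ i $ j \<ge> 0"
    and C_pos_iff: "\<And>i j. C $ i $ j > 0 \<longleftrightarrow> (j, i) \<in> parcs D"
    and indep_Z: "indep_vars (\<lambda>_. pos_borel) Z UNIV"
    and atom_free_Z: "\<And>i x. measure (distr M pos_borel (Z i)) {x} = 0"
    and support_Z: "\<And>i. msupport (distr M pos_borel (Z i)) = {0<..}"
    and X_eq: "\<And>i \<omega>. \<omega> \<in> space M \<Longrightarrow>
      X i \<omega> = Max (insert (Z i \<omega>) ((\<lambda>j. C $ i $ j * X j \<omega>) ` {j. (j, i) \<in> parcs D}))"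

definition impact_graph ::
    "real^'n^'n::finite \<Rightarrow> ('n \<Rightarrow> 'w \<Rightarrow> real) \<Rightarrow> ('n \<Rightarrow> 'w \<Rightarrow> real) \<Rightarrow> 'w \<Rightarrow> 'n pair_pre_digraph" where
  "impact_graph Cs Z X \<omega> =
     \<lparr>pverts = UNIV, parcs = {(j, i). i \<noteq> j \<and> X i \<omega> = Cs $ i $ j * Z j \<omega>}\<rparr>"

definition impact_graphs ::
    "'w measure \<Rightarrow> real^'n^'n::finite \<Rightarrow> ('n \<Rightarrow> 'w \<Rightarrow> real) \<Rightarrow> ('n \<Rightarrow> 'w \<Rightarrow> real)
      \<Rightarrow> 'n pair_pre_digraph set" where
  "impact_graphs M Cs Z X = {g. measure M {\<omega> \<in> space M. impact_graph Cs Z X \<omega> = g} > 0}"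

end

theory Submission
  imports Defs
begin

text \<open>
  Eliminating the recursion gives \<open>X\<^sub>i = max\<^sub>j c\<^sup>*\<^sub>i\<^sub>j Z\<^sub>j\<close> (\<open>max_linear_solution\<close>), so the impact graph records which
  innovation attains the maximum at each node.  The theorem asks when a prescribed pattern of maximizers
  has positive probability.

  Since the innovations are independent and atom-free, ties \<open>c\<^sup>*\<^sub>i\<^sub>j Z\<^sub>j = c\<^sup>*\<^sub>i\<^sub>k Z\<^sub>k > 0\<close> with \<open>j \<noteq> k\<close> have probability zero
  (\<open>AE_tie_free\<close>).  A graph of positive probability is therefore the impact graph of some tie-free vector
  of innovations \<open>z\<close>, and the four conditions are necessary for a deterministic reason: the
  inequality \<open>c\<^sup>*\<^sub>i\<^sub>k c\<^sup>*\<^sub>k\<^sub>j \<le> c\<^sup>*\<^sub>i\<^sub>j\<close> turns a second parent, a path of length two, or a violation of the third condition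
  into a tie or into a larger contribution, and \<open>z\<close> restricted to the roots satisfies
  \<open>m\<^sub>r\<^sub>s z\<^sub>s < z\<^sub>r\<close> whenever \<open>m\<^sub>r\<^sub>s > 0\<close>, so that the product of the entries along any cycle is below 1.

  Conversely, it suffices to find one positive \<open>z\<close> for which the centre of each star strictly decides
  all nodes of the star.  Strict inequalities persist on a box around \<open>z\<close> (\<open>realization_box\<close>), and independence
  together with full support gives the box positive probability.  A bound below 1 on all cycle products
  of \<open>M(g)\<close> yields values \<open>y\<close> on the roots with \<open>m\<^sub>r\<^sub>s y\<^sub>s < y\<^sub>r\<close> (\<open>potential_exists\<close>).  These decide the children correctly.  To
  let each root decide itself as well, \<open>y\<close> is replaced by its max-linear closure over the roots (\<open>root_potential\<close>),
  which is where the third condition enters, and then perturbed slightly according to depth in the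
  reachability DAG, the non-roots receiving a tiny innovation (\<open>strict_realization\<close>).
\<close>

section \<open>The Kleene star of a weighted acyclic digraph\<close>

text \<open>
  The arc \<open>(v, u)\<close> carries the weight \<open>A u v\<close>, the matrix convention of the network: this one product
  serves both for paths of the network and for cycles of the impact exchange matrix.
\<close>

definition arc_product :: "('a \<Rightarrow> 'a \<Rightarrow> real) \<Rightarrow> ('a \<times> 'a) list \<Rightarrow> real" where
  "arc_product A p = (\<Prod>(v, u)\<leftarrow>p. A u v)"

lemma arc_product_simps [simp]:
  "arc_product A [] = 1"
  "arc_product A (e # p) = A (snd e) (fst e) * arc_product A p"
  "arc_product A (p @ q) = arc_product A p * arc_product A q"
  by (simp_all add: arc_product_def case_prod_unfold)

locale weighted_dag =
  fixes D :: "'n::finite pair_pre_digraph"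
    and C :: "real^'n^'n"
  assumes verts_UNIV: "pverts D = UNIV"
    and acyclic_D: "dag D"
    and weight_nonneg: "C $ i $ j \<ge> 0"
    and weight_pos_iff: "C $ i $ j > 0 \<longleftrightarrow> (j, i) \<in> parcs D"
begin

sublocale D: pair_fin_digraph D
  using acyclic_D by (simp add: dag_def)

abbreviation walk_weight :: "('n \<times> 'n) list \<Rightarrow> real" where
  "walk_weight \<equiv> arc_product (\<lambda>i j. C $ i $ j)"

lemma walk_weight_pos: "set p \<subseteq> parcs D \<Longrightarrow> walk_weight p > 0"
  by (induction p) (auto simp: weight_pos_iff)

lemma closed_awalk_Nil: "D.awalk u p u \<Longrightarrow> p = []"
  using acyclic_D D.closed_w_imp_cycle[of p]
  by (auto simp: dag_def D.closed_w_def)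

text \<open>
  A repeated vertex would enclose a closed walk.  Hence in an acyclic graph the Kleene star, a
  maximum over paths, may be handled as a maximum over walks, and walks can be concatenated.
\<close>

lemma awalk_imp_apath:
  assumes "D.awalk u p v"
  shows "D.apath u p v"
proof (rule ccontr)
  assume "\<not> D.apath u p v"
  with assms have "\<not> distinct (pawalk_verts u p)"
    by (simp add: D.apath_def)
  then obtain r w where "0 < length r" "D.awalk w r w"
    using D.awalk_not_distinct_decomp[OF assms] by blast
  with closed_awalk_Nil show False by auto
qed

abbreviation Cs :: "real^'n^'n" where "Cs \<equiv> kleene_star D C"

lemma finite_apath_weights: "finite {walk_weight p |p. D.apath j p i}"
  using D.apaths_finite[of j i] by simp

lemma kleene_star_offdiag:
  assumes "i \<noteq> j"
  shows "Cs $ i $ j =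
    (if \<exists>p. D.apath j p i then Max {walk_weight p |p. D.apath j p i} else 0)"
  using assms by (simp add: kleene_star_def arc_product_def)

lemma kleene_star_diag: "Cs $ i $ i = 1"
  by (simp add: kleene_star_def)

lemma walk_weight_le_kleene_star:
  assumes "D.awalk j p i"
  shows "walk_weight p \<le> Cs $ i $ j"
proof (cases "i = j")
  case True
  then show ?thesis using assms closed_awalk_Nil[of j p] by (simp add: kleene_star_diag)
next
  case False
  have "D.apath j p i" by (rule awalk_imp_apath[OF assms])
  with False show ?thesis
    using finite_apath_weights[of j i] by (auto simp: kleene_star_offdiag intro!: Max_ge)
qed

lemma kleene_star_attained:
  assumes "Cs $ i $ j \<noteq> 0"
  obtains p where "D.awalk j p i" "Cs $ i $ j = walk_weight p"
proof (cases "i = j")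
  case True
  have "D.awalk j [] j" by (simp add: D.awalk_Nil_iff verts_UNIV)
  with True show ?thesis using that by (simp add: kleene_star_diag)
next
  case False
  with assms have ex: "\<exists>p. D.apath j p i"
    by (auto simp: kleene_star_offdiag split: if_splits)
  with False have "Cs $ i $ j = Max {walk_weight p |p. D.apath j p i}"
    by (simp add: kleene_star_offdiag)
  moreover have "Max {walk_weight p |p. D.apath j p i} \<in> {walk_weight p |p. D.apath j p i}"
    using ex by (intro Max_in finite_apath_weights) auto
  ultimately show ?thesis using that by (auto simp: D.apath_def)
qed

lemma kleene_star_nonneg: "Cs $ i $ j \<ge> 0"
proof (cases "Cs $ i $ j = 0")
  case False
  then obtain p where "D.awalk j p i" "Cs $ i $ j = walk_weight p"
    by (rule kleene_star_attained)
  then show ?thesis using walk_weight_pos[of p] by (auto simp: D.awalk_def)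
qed simp

text \<open>
  Concatenating optimal walks from \<open>j\<close> to \<open>k\<close> and from \<open>k\<close> to \<open>i\<close> gives a competitor for
  \<open>c\<^sup>*\<^sub>i\<^sub>j\<close>.  This inequality, nonnegativity, antisymmetry and the unit diagonal are all that the
  combinatorial part of the proof knows about the Kleene star.
\<close>

lemma kleene_star_supermultiplicative: "Cs $ i $ k * Cs $ k $ j \<le> Cs $ i $ j"
proof (cases "Cs $ i $ k = 0 \<or> Cs $ k $ j = 0")
  case True
  then show ?thesis using kleene_star_nonneg by auto
next
  case False
  then obtain p q where "D.awalk k p i" "Cs $ i $ k = walk_weight p"
    and "D.awalk j q k" "Cs $ k $ j = walk_weight q"
    by (metis kleene_star_attained)
  then show ?thesis
    using walk_weight_le_kleene_star[OF D.awalk_appendI, of j q k p i] by (simp add: mult.commute)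
qed

lemma kleene_star_antisym:
  assumes "i \<noteq> j" "Cs $ i $ j > 0"
  shows "Cs $ j $ i = 0"
proof (rule ccontr)
  assume "Cs $ j $ i \<noteq> 0"
  then obtain q where q: "D.awalk i q j" by (rule kleene_star_attained)
  obtain p where p: "D.awalk j p i" using assms(2) kleene_star_attained[of i j] by auto
  have "p @ q = []" by (rule closed_awalk_Nil[OF D.awalk_appendI[OF p q]])
  with p have "j = i" by (simp add: D.awalk_Nil_iff)
  with assms show False by simp
qed

lemma edge_le_kleene_star:
  assumes "(j, i) \<in> parcs D"
  shows "C $ i $ j \<le> Cs $ i $ j"
  using walk_weight_le_kleene_star[OF D.arc_implies_awalk[OF assms]] by simp

text \<open>
  The last edge of an optimal path; supermultiplicativity would give equality.
\<close>

lemma kleene_star_last_edge: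
  assumes "i \<noteq> j" "Cs $ i $ j > 0"
  obtains k where "(k, i) \<in> parcs D" "Cs $ i $ j \<le> C $ i $ k * Cs $ k $ j"
proof -
  obtain p where p: "D.awalk j p i" "Cs $ i $ j = walk_weight p"
    using assms(2) kleene_star_attained[of i j] by auto
  with assms(1) have "p \<noteq> []" by (auto simp: D.awalk_Nil_iff)
  then obtain q k i' where "p = q @ [(k, i')]" by (metis rev_exhaust surj_pair)
  with p have "D.awalk j q k" "(k, i) \<in> parcs D" "walk_weight p = walk_weight q * C $ i $ k"
    by (auto simp: D.awalk_Cons_iff D.awalk_Nil_iff)
  moreover have "walk_weight q * C $ i $ k \<le> Cs $ k $ j * C $ i $ k"
    using walk_weight_le_kleene_star[OF \<open>D.awalk j q k\<close>] weight_nonneg[of i k]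
    by (rule mult_right_mono)
  ultimately show ?thesis using that[of k] p(2) by (simp add: mult.commute)
qed

lemma parent_induct:
  assumes "\<And>i. (\<And>j. (j, i) \<in> parcs D \<Longrightarrow> P j) \<Longrightarrow> P i"
  shows "P i"
proof -
  have "acyclic (parcs D)"
    using closed_awalk_Nil by (auto simp: acyclic_def D.reachable1_awalk)
  then have "wf (parcs D)"
    using D.finite_arcs by (auto intro: finite_acyclic_wf)
  then show ?thesis
    by (induction i rule: wf_induct_rule) (rule assms)
qed

text \<open>
  The recursion unrolled, by induction along the edges: \<open>X\<^sub>i = max\<^sub>j c\<^sup>*\<^sub>i\<^sub>j Z\<^sub>j\<close>, stated as an upper bound that is
  attained.
\<close>

lemma max_linear_solution:
  fixes x z :: "'n \<Rightarrow> real"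
  assumes z: "\<And>i. z i > 0"
    and x: "\<And>i. x i = Max (insert (z i) ((\<lambda>j. C $ i $ j * x j) ` {j. (j, i) \<in> parcs D}))"
  shows "Cs $ i $ j * z j \<le> x i" and "\<exists>j. x i = Cs $ i $ j * z j"
proof -
  have zx: "z i \<le> x i" for i by (subst x) simp
  have step: "C $ i $ k * x k \<le> x i" if "(k, i) \<in> parcs D" for i k
    using that by (subst (2) x) (auto intro!: Max_ge)
  have upper: "Cs $ i $ j * z j \<le> x i" for i j
  proof (induction i rule: parent_induct)
    case (1 i)
    consider "i = j" | "Cs $ i $ j = 0" | "i \<noteq> j" "Cs $ i $ j > 0"
      using kleene_star_nonneg[of i j] by linarith
    then show ?case
    proof cases
      case 1
      then show ?thesis using zx[of i] by (simp add: kleene_star_diag)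
    next
      case 2
      then show ?thesis using zx[of i] z[of i] by simp
    next
      case 3
      then obtain k where k: "(k, i) \<in> parcs D" "Cs $ i $ j \<le> C $ i $ k * Cs $ k $ j"
        by (rule kleene_star_last_edge)
      have "Cs $ i $ j * z j \<le> C $ i $ k * Cs $ k $ j * z j"
        using k(2) z[of j] by (simp add: mult_right_mono)
      also have "\<dots> \<le> C $ i $ k * x k"
        using "1"[OF k(1)] weight_nonneg[of i k] by (simp add: mult.assoc mult_left_mono)
      finally show ?thesis using step[OF k(1)] by linarith
    qed
  qed
  then show "Cs $ i $ j * z j \<le> x i" .
  show "\<exists>j. x i = Cs $ i $ j * z j"
  proof (induction i rule: parent_induct)
    case (1 i)
    have "x i \<in> insert (z i) ((\<lambda>j. C $ i $ j * x j) ` {j. (j, i) \<in> parcs D})"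
      by (subst x) (rule Max_in, auto)
    then consider "x i = Cs $ i $ i * z i" | k where "(k, i) \<in> parcs D" "x i = C $ i $ k * x k"
      by (auto simp: kleene_star_diag)
    then show ?case
    proof cases
      case 2
      from "1"[OF 2(1)] obtain j where "x k = Cs $ k $ j * z j" by blast
      then have "x i = C $ i $ k * Cs $ k $ j * z j" using 2 by simp
      also have "\<dots> \<le> Cs $ i $ k * Cs $ k $ j * z j"
        using edge_le_kleene_star[OF 2(1)] kleene_star_nonneg[of k j] z[of j]
        by (intro mult_right_mono) auto
      also have "\<dots> \<le> Cs $ i $ j * z j"
        using kleene_star_supermultiplicative[of i k j] z[of j] by (simp add: mult_right_mono)
      finally show ?thesis using upper[of i j] by (intro exI[of _ j]) simp
    qed blast
  qed
qed

end

section \<open>Galaxies\<close>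

text \<open>
  Two arcs that share a vertex lie in the same star, because the stars are disjoint.  There a second
  parent contradicts the in-degree bound, and two consecutive arcs form a path of length two, as
  acyclicity makes the three vertices distinct.
\<close>

lemma galaxyD:
  assumes "galaxy g"
  shows "(u, v) \<in> parcs g \<Longrightarrow> (w, v) \<in> parcs g \<Longrightarrow> u = w"
    and "(u, v) \<in> parcs g \<Longrightarrow> (v, w) \<notin> parcs g"
proof -
  obtain \<T> where star: "\<And>t. t \<in> \<T> \<Longrightarrow> star t" and T: "disjoint_union_of \<T> g"
    using assms by (auto simp: galaxy_def)
  have dag: "dag t" if "t \<in> \<T>" for t
    using star[OF that] by (simp add: star_def rooted_tree_def)
  have fin: "pair_fin_digraph t" if "t \<in> \<T>" for t
    using dag[OF that] by (simp add: dag_def)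
  have arc: "\<exists>t\<in>\<T>. (a, b) \<in> parcs t" if "(a, b) \<in> parcs g" for a b
    using that T by (auto simp: disjoint_union_of_def)
  have vertex: "a \<in> pverts t" "b \<in> pverts t" if "t \<in> \<T>" "(a, b) \<in> parcs t" for a b t
    using that fin[OF that(1)] pair_wf_digraph.wellformed' pair_fin_digraph.axioms(1) by metis+
  have same: "s = t" if "s \<in> \<T>" "t \<in> \<T>" "a \<in> pverts s" "a \<in> pverts t" for s t a
    using T that by (auto simp: disjoint_union_of_def pairwise_def)
  show "u = w" if uv: "(u, v) \<in> parcs g" and wv: "(w, v) \<in> parcs g"
  proof -
    obtain t where t: "t \<in> \<T>" "(u, v) \<in> parcs t" "(w, v) \<in> parcs t"
      using arc[OF uv] arc[OF wv] vertex same by metis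
    interpret t: pair_fin_digraph t by (rule fin[OF t(1)])
    have "in_degree (with_proj t) v \<le> 1"
      using star[OF t(1)] vertex[OF t(1,2)] by (simp add: star_def rooted_tree_def)
    moreover have "{(u, v), (w, v)} \<subseteq> in_arcs (with_proj t) v"
      using t by (auto simp: in_arcs_def)
    moreover have "finite (in_arcs (with_proj t) v)"
      using t.pair_finite_arcs by (auto simp: in_arcs_def)
    ultimately have "card {(u, v), (w, v)} \<le> 1"
      unfolding in_degree_def by (meson card_mono le_trans)
    then show "u = w" by (auto simp: card_insert_if split: if_splits)
  qed
  show "(v, w) \<notin> parcs g" if uv: "(u, v) \<in> parcs g"
  proof
    assume "(v, w) \<in> parcs g"
    then obtain t where t: "t \<in> \<T>" "(u, v) \<in> parcs t" "(v, w) \<in> parcs t"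
      using arc[OF uv] arc[of v w] vertex same by metis
    interpret t: pair_fin_digraph t by (rule fin[OF t(1)])
    have acyclic: "p = []" if "t.awalk a p a" for a p
      using dag[OF t(1)] that t.closed_w_imp_cycle[of p] by (auto simp: dag_def t.closed_w_def)
    have walks: "t.awalk u [(u, v)] v" "t.awalk v [(v, w)] w" "t.awalk u [(u, v), (v, w)] w"
      using t vertex by (auto simp: t.awalk_Cons_iff t.awalk_Nil_iff)
    with acyclic have "u \<noteq> v" "v \<noteq> w" "u \<noteq> w" by blast+
    with walks(3) have "t.apath u [(u, v), (v, w)] w" by (auto simp: t.apath_def)
    moreover have "finite {length p |u p v. t.apath u p v}"
    proof -
      have "{length p |u p v. t.apath u p v} = (\<lambda>(u, p, v). length p) ` {(u, p, v). t.apath u p v}"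
        by force
      then show ?thesis using t.apaths_finite_triple by simp
    qed
    ultimately have "length [(u, v), (v, w)] \<le> height t"
      unfolding height_def by (intro Max_ge) blast+
    with star[OF t(1)] show False by (simp add: star_def)
  qed
qed

text \<open>
  Every nonempty walk in such a graph is a single arc from the centre to a leaf; acyclicity and the
  bound on the height both follow from this.
\<close>

lemma star_single_centre:
  fixes r :: "'n::finite"
  assumes "r \<notin> L"
  shows "star \<lparr>pverts = insert r L, parcs = {r} \<times> L\<rparr>" (is "star ?t")
proof -
  interpret t: pair_fin_digraph ?t
    by unfold_locales (auto intro: finite_subset[OF subset_UNIV])
  have short: "length p \<le> 1 \<and> (p \<noteq> [] \<longrightarrow> u = r \<and> v \<in> L)" if "t.awalk u p v" for u p v
    using that
  proof (induction p arbitrary: u)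
    case (Cons e p)
    then have e: "u = r" "snd e \<in> L" "t.awalk (snd e) p v"
      by (auto simp: t.awalk_Cons_iff)
    with Cons.IH[OF e(3)] assms have "p = []" by blast
    with e show ?case by (simp add: t.awalk_Nil_iff)
  qed simp
  have "\<not> t.cycle p" for p
    using short assms by (auto simp: t.cycle_def)
  then have "dag ?t" by (auto simp: dag_def intro: t.pair_fin_digraph)
  moreover have "Digraph_Component.connected (with_proj ?t)"
  proof -
    have "u \<rightarrow>\<^sup>*\<^bsub>mk_symmetric (with_proj ?t)\<^esub> v" if "u \<in> insert r L" "v \<in> insert r L" for u v
    proof -
      interpret s: pair_wf_digraph "mk_symmetric (with_proj ?t)"
        by (rule t.wellformed_mk_symmetric)
      have "u \<rightarrow>\<^sup>*\<^bsub>mk_symmetric (with_proj ?t)\<^esub> r" "r \<rightarrow>\<^sup>*\<^bsub>mk_symmetric (with_proj ?t)\<^esub> v"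
        using that by (cases "u = r"; cases "v = r"; simp add: parcs_mk_symmetric)+
      then show ?thesis by (rule s.reachable_trans)
    qed
    then show ?thesis
      by (auto simp: Digraph_Component.connected_def strongly_connected_def)
  qed
  moreover have "in_degree (with_proj ?t) v \<le> 1" for v
  proof -
    have "in_arcs (with_proj ?t) v \<subseteq> {(r, v)}" by (auto simp: in_arcs_def)
    then have "card (in_arcs (with_proj ?t) v) \<le> card {(r, v)}" by (intro card_mono) auto
    then show ?thesis by (simp add: in_degree_def)
  qed
  moreover have "height ?t \<le> 1"
  proof -
    have "{length p |u p v. t.apath u p v} \<subseteq> {..1}"
      using short by (auto simp: t.apath_def)
    moreover have "t.apath r [] r" by (simp add: t.apath_Nil_iff)
    then have "{length p |u p v. t.apath u p v} \<noteq> {}" by blast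
    moreover note finite_subset[OF calculation(1)]
    ultimately show ?thesis unfolding height_def by (subst Max_le_iff) auto
  qed
  ultimately show ?thesis by (simp add: star_def rooted_tree_def)
qed

text \<open>
  The stars are the sets consisting of a root and its children.  A vertex that is not a root has a
  parent, and that parent is a root because there is no path of length two.
\<close>

lemma galaxyI:
  fixes g :: "'n::finite pair_pre_digraph"
  assumes verts: "pverts g = UNIV"
    and unique: "\<And>u v w. (u, v) \<in> parcs g \<Longrightarrow> (w, v) \<in> parcs g \<Longrightarrow> u = w"
    and short: "\<And>u v w. (u, v) \<in> parcs g \<Longrightarrow> (v, w) \<notin> parcs g"
  shows "galaxy g"
proof -
  define t where "t r = \<lparr>pverts = insert r (children g r), parcs = {r} \<times> children g r\<rparr>" for r
  have "star (t r)" for r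
    unfolding t_def using short by (intro star_single_centre) (auto simp: children_def)
  moreover have "disjoint_union_of (t ` roots g) g"
    unfolding disjoint_union_of_def
  proof (intro conjI)
    show "pairwise (\<lambda>s t. pverts s \<inter> pverts t = {}) (t ` roots g)"
    proof (intro pairwiseI)
      fix s s' assume "s \<in> t ` roots g" "s' \<in> t ` roots g" "s \<noteq> s'"
      then obtain a b where "s = t a" "s' = t b" "a \<in> roots g" "b \<in> roots g" "a \<noteq> b" by blast
      then show "pverts s \<inter> pverts s' = {}"
        using unique[of a _ b] by (auto simp: t_def children_def roots_def)
    qed
    show "pverts g = (\<Union>t\<in>t ` roots g. pverts t)"
    proof -
      have "\<exists>r\<in>roots g. v = r \<or> (r, v) \<in> parcs g" for v
        using short verts by (cases "v \<in> roots g") (auto simp: roots_def)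
      then show ?thesis using verts by (auto simp: t_def children_def)
    qed
    show "parcs g = (\<Union>t\<in>t ` roots g. parcs t)"
      using short verts by (auto simp: t_def children_def roots_def)
  qed
  ultimately show ?thesis unfolding galaxy_def by (intro exI[of _ "t ` roots g"]) blast
qed

section \<open>Cycle means and potentials\<close>

lemma weight_digraph_simps [simp]:
  "pverts (weight_digraph S A) = S"
  "(v, u) \<in> parcs (weight_digraph S A) \<longleftrightarrow> v \<in> S \<and> u \<in> S \<and> A u v > 0"
  by (simp_all add: weight_digraph_def)

lemma pair_fin_digraph_weight_digraph:
  assumes "finite S"
  shows "pair_fin_digraph (weight_digraph S A)"
proof
  show "finite (parcs (weight_digraph S A))"
    by (rule finite_subset[of _ "S \<times> S"]) (use assms in auto)
qed (use assms in auto)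

lemma arc_product_pos: "set p \<subseteq> parcs (weight_digraph S A) \<Longrightarrow> arc_product A p > 0"
  by (induction p) auto

lemma max_cycle_mean_less_1_iff:
  assumes "finite S"
  shows "max_cycle_mean S A < 1 \<longleftrightarrow>
    (\<forall>p. pre_digraph.cycle (with_proj (weight_digraph S A)) p \<longrightarrow> arc_product A p < 1)"
proof -
  interpret W: pair_fin_digraph "weight_digraph S A"
    by (rule pair_fin_digraph_weight_digraph[OF assms])
  have "{p. W.cycle p} \<subseteq> {p. set p \<subseteq> parcs (weight_digraph S A) \<and> distinct p}"
    by (auto simp: W.cycle_conv W.awalk_def)
  then have fin: "finite {p. W.cycle p}"
    by (rule finite_subset) (intro finite_subset_distinct W.finite_arcs)
  have less_1: "root (length p) (arc_product A p) < 1 \<longleftrightarrow> arc_product A p < 1" if "W.cycle p" for p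
    using that by (auto simp: W.cycle_def)
  show ?thesis
  proof (cases "\<exists>p. W.cycle p")
    case True
    then have "{p. W.cycle p} \<noteq> {}" by blast
    moreover have "max_cycle_mean S A = Max ((\<lambda>p. root (length p) (arc_product A p)) ` {p. W.cycle p})"
      using True by (simp add: max_cycle_mean_def arc_product_def image_Collect)
    ultimately show ?thesis using fin less_1 by (auto simp: Max_less_iff)
  next
    case False
    then show ?thesis by (simp add: max_cycle_mean_def)
  qed
qed

text \<open>
  A closed walk splits at a repeated vertex into two shorter closed walks, so the bound on cycles
  passes to all closed walks.
\<close>

lemma closed_walk_product_less_1:
  assumes "finite S" "max_cycle_mean S A < 1"
    and "pre_digraph.awalk (with_proj (weight_digraph S A)) u p u" "p \<noteq> []"
  shows "arc_product A p < 1"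
  using assms(3,4)
proof (induction "length p" arbitrary: u p rule: less_induct)
  case less
  interpret W: pair_fin_digraph "weight_digraph S A"
    by (rule pair_fin_digraph_weight_digraph[OF assms(1)])
  show ?case
  proof (cases "W.cycle p")
    case True
    then show ?thesis using assms(2) by (simp add: max_cycle_mean_less_1_iff[OF assms(1)])
  next
    case False
    from less.prems(2) obtain e es where p: "p = e # es" by (cases p) auto
    with less.prems have e: "e \<in> parcs (weight_digraph S A)" "u = fst e" "W.awalk (snd e) es u"
      by (auto simp: W.awalk_Cons_iff)
    from False p less.prems(1) have "\<not> distinct (pawalk_verts (snd e) es)"
      by (force simp: W.cycle_def)
    then obtain q r s w where es: "es = q @ r @ s" and r: "r \<noteq> []"
      and walks: "W.awalk (snd e) q w" "W.awalk w r w" "W.awalk w s u"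
      using W.awalk_not_distinct_decomp[OF e(3)] by auto
    have "W.awalk u (e # q @ s) u"
      using e(1,2) W.awalk_appendI[OF walks(1,3)] by (simp add: W.awalk_Cons_iff)
    then have outer: "arc_product A (e # q @ s) < 1"
      using less.hyps[of "e # q @ s" u] p es r by simp
    have inner: "arc_product A r < 1"
      using less.hyps[of r w] p es r walks(2) by simp
    have "arc_product A r > 0"
      using walks(2) by (intro arc_product_pos[of _ S]) (auto simp: W.awalk_def)
    then have "arc_product A (e # q @ s) * arc_product A r < 1 * arc_product A r"
      using outer by (intro mult_strict_right_mono)
    then have "arc_product A (e # q @ s) * arc_product A r < 1"
      using inner by linarith
    then show ?thesis by (simp add: p es ac_simps)
  qed
qed

lemma between_finite_sets:
  fixes L U :: "real set"
  assumes "finite L" "finite U" "\<And>l u. l \<in> L \<Longrightarrow> u \<in> U \<Longrightarrow> l < u"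
  obtains t where "\<And>l. l \<in> L \<Longrightarrow> l < t" "\<And>u. u \<in> U \<Longrightarrow> t < u"
proof (cases "L = {} \<or> U = {}")
  case True
  then show ?thesis
  proof
    assume "L = {}"
    then show ?thesis using that[of "Min U - 1"] assms(2)
      by (metis Min_le diff_less_eq empty_iff less_add_same_cancel1 order_less_le_trans zero_less_one)
  next
    assume "U = {}"
    then show ?thesis using that[of "Max L + 1"] assms(1)
      by (metis Max_ge empty_iff less_add_same_cancel1 order_le_less_trans zero_less_one)
  qed
next
  case False
  with assms have "Max L < Min U" by simp
  then obtain t where "Max L < t" "t < Min U" using dense by blast
  with assms False show ?thesis by (intro that[of t]) auto
qed

text \<open>
  A max-plus Farkas lemma, proved by Fourier--Motzkin elimination of one vertex \<open>s\<close> at a time: replacing \<open>A u v\<close> by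
  \<open>max (A u v) (A u s * A s v)\<close> turns every detour through \<open>s\<close> into a single arc, so closed walks
  of the reduced matrix come from closed walks of the original one, and the reduced inequalities say
  exactly that every lower bound on the missing value \<open>z s\<close> lies below every upper bound.  Cycles do
  not survive this step as cycles, since a cycle of the reduced matrix may expand to a walk that passes
  \<open>s\<close> several times; this is why the hypothesis speaks of closed walks.
\<close>

lemma potential_exists:
  assumes "finite S" and "\<And>u v. A u v \<ge> 0"
    and "\<And>u p. pre_digraph.awalk (with_proj (weight_digraph S A)) u p u \<Longrightarrow> p \<noteq> [] \<Longrightarrow>
      arc_product A p < 1"
  shows "\<exists>z. (\<forall>v. z v > 0) \<and> (\<forall>u\<in>S. \<forall>v\<in>S. A u v * z v < z u)"
  using assms
proof (induction S arbitrary: A rule: finite_induct)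
  case empty
  show ?case by (intro exI[of _ "\<lambda>_. 1"]) simp
next
  case (insert s S)
  note nonneg = insert.prems(1)
  define B where "B u v = max (A u v) (A u s * A s v)" for u v
  interpret W: pair_fin_digraph "weight_digraph (insert s S) A"
    using insert.hyps by (intro pair_fin_digraph_weight_digraph) simp
  interpret W': pair_fin_digraph "weight_digraph S B"
    using insert.hyps by (intro pair_fin_digraph_weight_digraph) simp
  have detour: "\<exists>q. W.awalk u q v \<and> arc_product A q = arc_product B p \<and> (p \<noteq> [] \<longrightarrow> q \<noteq> [])"
    if "W'.awalk u p v" for u p v
    using that
  proof (induction p arbitrary: u)
    case Nil
    then show ?case by (intro exI[of _ "[]"]) (auto simp: W.awalk_Nil_iff W'.awalk_Nil_iff)
  next
    case (Cons e p)
    obtain x where e: "e = (u, x)" and ux: "u \<in> S" "x \<in> S" "B x u > 0" and "W'.awalk x p v"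
      using Cons.prems by (cases e) (auto simp: W'.awalk_Cons_iff)
    then obtain q where q: "W.awalk x q v" "arc_product A q = arc_product B p"
      using Cons.IH by blast
    show ?case
    proof (cases "B x u = A x u")
      case True
      then show ?thesis using e ux q
        by (intro exI[of _ "(u, x) # q"]) (auto simp: W.awalk_Cons_iff)
    next
      case False
      then have "B x u = A x s * A s u" by (auto simp: B_def)
      moreover from this have "A x s > 0" "A s u > 0"
        using ux(3) nonneg[of x s] nonneg[of s u] by (auto simp: zero_less_mult_iff)
      ultimately show ?thesis using e ux q
        by (intro exI[of _ "(u, s) # (s, x) # q"]) (auto simp: W.awalk_Cons_iff)
    qed
  qed
  have "arc_product B p < 1" if "W'.awalk u p u" "p \<noteq> []" for u p
    using detour[OF that(1)] insert.prems(2) that(2) by metis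
  moreover have "B u v \<ge> 0" for u v
    using nonneg by (simp add: B_def le_max_iff_disj)
  ultimately obtain z where z: "\<And>v. z v > 0" and less: "\<And>u v. u \<in> S \<Longrightarrow> v \<in> S \<Longrightarrow> B u v * z v < z u"
    using insert.IH[of B] by metis
  \<comment> \<open>\<open>t\<close> will be the value of the potential at \<open>s\<close>; the bound 0 makes it positive.\<close>
  obtain t where lower: "\<And>l. l \<in> insert 0 ((\<lambda>v. A s v * z v) ` S) \<Longrightarrow> l < t"
    and upper: "\<And>b. b \<in> (\<lambda>u. z u / A u s) ` {u \<in> S. A u s > 0} \<Longrightarrow> t < b"
  proof (rule between_finite_sets[of "insert 0 ((\<lambda>v. A s v * z v) ` S)"
          "(\<lambda>u. z u / A u s) ` {u \<in> S. A u s > 0}"])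
    fix l b
    assume "l \<in> insert 0 ((\<lambda>v. A s v * z v) ` S)"
      and "b \<in> (\<lambda>u. z u / A u s) ` {u \<in> S. A u s > 0}"
    then obtain u where u: "u \<in> S" "A u s > 0" "b = z u / A u s"
      and l: "l = 0 \<or> (\<exists>v\<in>S. l = A s v * z v)" by auto
    from l show "l < b"
    proof
      assume "\<exists>v\<in>S. l = A s v * z v"
      then obtain v where v: "v \<in> S" "l = A s v * z v" by blast
      have "A u s * A s v * z v \<le> B u v * z v"
        using z[of v] by (simp add: B_def)
      also have "\<dots> < z u" using less u v by simp
      finally show ?thesis using u v by (simp add: pos_less_divide_eq mult_ac)
    qed (use u z in simp)
  qed (use insert.hyps in auto)
  have "A s s < 1"
  proof (cases "A s s = 0")
    case False
    then have "W.awalk s [(s, s)] s"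
      using nonneg[of s s] by (simp add: W.awalk_Cons_iff W.awalk_Nil_iff)
    then show ?thesis using insert.prems(2)[of s "[(s, s)]"] by simp
  qed simp
  have "t > 0" using lower by simp
  have "A u s * t < z u" if "u \<in> S" for u
  proof (cases "A u s = 0")
    case True
    then show ?thesis using z by simp
  next
    case False
    with nonneg[of u s] have "A u s > 0" by simp
    then show ?thesis using upper[of "z u / A u s"] that by (simp add: pos_less_divide_eq mult.commute)
  qed
  moreover have "A s v * z v < t" if "v \<in> S" for v using lower that by simp
  moreover have "A u v * z v < z u" if "u \<in> S" "v \<in> S" for u v
  proof -
    have "A u v * z v \<le> B u v * z v" using z[of v] by (simp add: B_def)
    also have "\<dots> < z u" using less that by simp
    finally show ?thesis .
  qed
  moreover have "A s s * t < t" using \<open>A s s < 1\<close> \<open>t > 0\<close> by simp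
  ultimately show ?case
    using z \<open>t > 0\<close> insert.hyps by (intro exI[of _ "z(s := t)"]) auto
qed

text \<open>
  The converse of the existence of potentials: multiplying the inequalities along a cycle cancels the
  values of the potential.
\<close>

lemma max_cycle_mean_less_1_if_potential:
  assumes "finite S" and "\<And>v. z v > 0" and "\<And>u v. u \<in> S \<Longrightarrow> v \<in> S \<Longrightarrow> A u v > 0 \<Longrightarrow> A u v * z v < z u"
  shows "max_cycle_mean S A < 1"
  unfolding max_cycle_mean_less_1_iff[OF assms(1)]
proof (intro allI impI)
  interpret W: pair_fin_digraph "weight_digraph S A"
    by (rule pair_fin_digraph_weight_digraph[OF assms(1)])
  have less: "arc_product A p * z u < z v" if "W.awalk u p v" "p \<noteq> []" for u p v
    using that
  proof (induction p arbitrary: u)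
    case (Cons e p)
    then obtain x where e: "e = (u, x)" "u \<in> S" "x \<in> S" "A x u > 0" "W.awalk x p v"
      by (cases e) (auto simp: W.awalk_Cons_iff)
    then have pos: "arc_product A p > 0" by (intro arc_product_pos[of _ S]) (auto simp: W.awalk_def)
    have "arc_product A (e # p) * z u = arc_product A p * (A x u * z u)"
      using e by simp
    also have "\<dots> < arc_product A p * z x"
      using e assms(3) pos by simp
    also have "\<dots> \<le> z v"
      using Cons.IH[OF e(5)] e(5) by (cases "p = []") (auto simp: W.awalk_Nil_iff)
    finally show ?case .
  qed simp
  fix p assume "W.cycle p"
  then obtain u where "W.awalk u p u" "p \<noteq> []" by (auto simp: W.cycle_def)
  from less[OF this] assms(2)[of u] show "arc_product A p < 1"
    by (simp add: mult_less_cancel_right2)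
qed

section \<open>Impact graphs of tie-free innovations\<close>

context weighted_dag
begin

text \<open>
  The arcs of the impact graph for the innovations \<open>z\<close>, with the solution \<open>X\<close> eliminated: node \<open>j\<close>
  points to \<open>i\<close> when \<open>j\<close> attains the maximum in \<open>X\<^sub>i = max\<^sub>k c\<^sup>*\<^sub>i\<^sub>k z\<^sub>k\<close>.
\<close>

definition impact_arcs :: "('n \<Rightarrow> real) \<Rightarrow> ('n \<times> 'n) set" where
  "impact_arcs z = {(j, i). i \<noteq> j \<and> (\<forall>k. Cs $ i $ k * z k \<le> Cs $ i $ j * z j)}"

definition tie_free :: "('n \<Rightarrow> real) \<Rightarrow> bool" where
  "tie_free z \<longleftrightarrow> (\<forall>i j k. j \<noteq> k \<longrightarrow> Cs $ i $ j > 0 \<longrightarrow> Cs $ i $ k > 0 \<longrightarrow>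
     Cs $ i $ j * z j \<noteq> Cs $ i $ k * z k)"

lemma impact_arc_pos:
  assumes "\<And>i. z i > 0" "(j, i) \<in> impact_arcs z"
  shows "i \<noteq> j" "Cs $ i $ j > 0"
proof -
  show "i \<noteq> j" using assms(2) by (simp add: impact_arcs_def)
  have "Cs $ i $ i * z i \<le> Cs $ i $ j * z j" using assms(2) by (auto simp: impact_arcs_def)
  with assms(1)[of i] have "0 < Cs $ i $ j * z j" by (simp add: kleene_star_diag)
  with assms(1)[of j] show "Cs $ i $ j > 0" by (simp add: zero_less_mult_iff)
qed

context
  fixes z :: "'n \<Rightarrow> real" and g :: "'n pair_pre_digraph"
  assumes z_pos: "\<And>i. z i > 0" and tie_free: "tie_free z"
    and verts_g: "pverts g = UNIV" and arcs_g: "parcs g = impact_arcs z"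
begin

lemma impact_arc_strict:
  assumes "(j, i) \<in> parcs g" "k \<noteq> j"
  shows "Cs $ i $ k * z k < Cs $ i $ j * z j"
proof (cases "Cs $ i $ k = 0")
  case True
  then show ?thesis
    using impact_arc_pos[OF z_pos] assms(1) z_pos by (auto simp: arcs_g)
next
  case False
  then have "Cs $ i $ k > 0" using kleene_star_nonneg[of i k] by simp
  moreover have "Cs $ i $ j > 0" using impact_arc_pos[OF z_pos] assms(1) by (simp add: arcs_g)
  ultimately have "Cs $ i $ k * z k \<noteq> Cs $ i $ j * z j"
    using tie_free assms(2) by (auto simp: tie_free_def)
  moreover have "Cs $ i $ k * z k \<le> Cs $ i $ j * z j"
    using assms(1) by (simp add: arcs_g impact_arcs_def)
  ultimately show ?thesis by simp
qed

lemma impact_unique_parent: "(j, i) \<in> parcs g \<Longrightarrow> (k, i) \<in> parcs g \<Longrightarrow> j = k"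
  using impact_arc_strict[of j i k] impact_arc_strict[of k i j] by fastforce

text \<open>
  If \<open>k\<close> decides \<open>j\<close> and \<open>j\<close> decides \<open>i\<close>, then \<open>k\<close> contributes to \<open>i\<close>, through \<open>j\<close>, at least as much
  as \<open>j\<close> does, contrary to the strict advantage of \<open>j\<close>.
\<close>

lemma impact_no_two_path:
  assumes ji: "(j, i) \<in> parcs g" and kj: "(k, j) \<in> parcs g"
  shows False
proof -
  have "z j \<le> Cs $ j $ k * z k"
    using kj by (simp add: arcs_g impact_arcs_def) (metis kleene_star_diag mult_1)
  then have "Cs $ i $ j * z j \<le> Cs $ i $ j * (Cs $ j $ k * z k)"
    using kleene_star_nonneg by (rule mult_left_mono)
  also have "\<dots> \<le> Cs $ i $ k * z k"
    using kleene_star_supermultiplicative[of i j k] z_pos[of k]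
    by (simp add: mult.assoc[symmetric] mult_right_mono)
  also have "\<dots> < Cs $ i $ j * z j"
    using impact_arc_strict[OF ji, of k] kj by (auto simp: arcs_g impact_arcs_def)
  finally show False by simp
qed

lemma impact_galaxy: "galaxy g"
  using impact_unique_parent impact_no_two_path by (intro galaxyI verts_g) blast+

text \<open>
  If \<open>k\<close> lies on an optimal path from \<open>j\<close> to \<open>i\<close>, then whatever beats \<open>j\<close> at \<open>k\<close> would, passed on along
  the rest of that path, beat \<open>j\<close> at \<open>i\<close>.
\<close>

lemma impact_shared_path:
  assumes ji: "(j, i) \<in> parcs g" and "j \<noteq> k" and eq: "Cs $ i $ j = Cs $ i $ k * Cs $ k $ j"
  shows "(k, i) \<notin> parcs g" "(j, k) \<in> parcs g"
proof -
  show "(k, i) \<notin> parcs g" using impact_unique_parent ji \<open>j \<noteq> k\<close> by blast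
  have "Cs $ i $ j > 0" using impact_arc_pos[OF z_pos] ji by (simp add: arcs_g)
  with eq have pos: "Cs $ i $ k > 0"
    using kleene_star_nonneg[of i k] kleene_star_nonneg[of k j] by (auto simp: zero_less_mult_iff)
  have "Cs $ k $ l * z l \<le> Cs $ k $ j * z j" for l
  proof -
    have "Cs $ i $ k * (Cs $ k $ l * z l) \<le> Cs $ i $ l * z l"
      using kleene_star_supermultiplicative[of i k l] z_pos[of l]
      by (simp add: mult.assoc[symmetric] mult_right_mono)
    also have "\<dots> \<le> Cs $ i $ j * z j" using ji by (simp add: arcs_g impact_arcs_def)
    also have "\<dots> = Cs $ i $ k * (Cs $ k $ j * z j)" by (simp add: eq)
    finally show ?thesis using pos by simp
  qed
  with \<open>j \<noteq> k\<close> show "(j, k) \<in> parcs g" by (auto simp: arcs_g impact_arcs_def)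
qed

text \<open>
  The innovations are themselves a potential: if \<open>i\<close> is the child of \<open>r\<close> that attains the entry of the
  matrix, then \<open>r\<close> beating \<open>s\<close> at \<open>i\<close> is the required inequality.
\<close>

lemma impact_cycle_mean: "max_cycle_mean (roots g) (impact_exchange Cs g) < 1"
proof (rule max_cycle_mean_less_1_if_potential[of _ z])
  fix r s
  assume "impact_exchange Cs g r s > 0"
  then have "r \<noteq> s" "children g r \<noteq> {}"
    and "impact_exchange Cs g r s = Max ((\<lambda>i. Cs $ i $ s / Cs $ i $ r) ` children g r)"
    by (auto simp: impact_exchange_def split: if_splits)
  moreover from this have "impact_exchange Cs g r s \<in> (\<lambda>i. Cs $ i $ s / Cs $ i $ r) ` children g r"
    by (simp add: Max_in)
  ultimately obtain i where i: "(r, i) \<in> parcs g" "impact_exchange Cs g r s = Cs $ i $ s / Cs $ i $ r"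
    unfolding children_def by blast
  moreover have "Cs $ i $ r > 0" using i impact_arc_pos[OF z_pos] by (simp add: arcs_g)
  ultimately show "impact_exchange Cs g r s * z s < z r"
    using impact_arc_strict[OF i(1), of s] \<open>r \<noteq> s\<close>
    unfolding i(2) by (simp add: divide_less_eq mult.commute)
qed (simp_all add: z_pos)

end

end

section \<open>Realizing a graph that satisfies the four conditions\<close>

lemma eventually_less_if_limits_less:
  fixes f h :: "'a \<Rightarrow> real"
  assumes "(f \<longlongrightarrow> a) F" "(h \<longlongrightarrow> b) F" "a < b"
  shows "\<forall>\<^sub>F x in F. f x < h x"
proof -
  have "\<forall>\<^sub>F x in F. 0 < h x - f x"
    using tendsto_diff[OF assms(2,1)] assms(3) by (intro order_tendstoD(1)) auto
  then show ?thesis by simp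
qed

context weighted_dag
begin

context
  fixes g :: "'n pair_pre_digraph"
  assumes verts_g: "pverts g = UNIV"
    and reachable: "\<And>i j. (j, i) \<in> parcs g \<Longrightarrow> i \<noteq> j \<and> Cs $ i $ j > 0"
    and galaxy_g: "galaxy g"
    and shared_path: "\<And>i j k. i \<noteq> j \<Longrightarrow> i \<noteq> k \<Longrightarrow> j \<noteq> k \<Longrightarrow> (j, i) \<in> parcs g \<Longrightarrow>
      Cs $ i $ j = Cs $ i $ k * Cs $ k $ j \<Longrightarrow> (k, i) \<notin> parcs g \<and> (j, k) \<in> parcs g"
    and cycle_mean: "max_cycle_mean (roots g) (impact_exchange Cs g) < 1"
begin

lemma child_ratio_le_impact_exchange:
  assumes "(r, i) \<in> parcs g" "r \<noteq> s"
  shows "Cs $ i $ s / Cs $ i $ r \<le> impact_exchange Cs g r s"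
  using assms by (auto simp: impact_exchange_def children_def intro!: Max_ge)

lemma impact_exchange_nonneg: "impact_exchange Cs g r s \<ge> 0"
proof (cases "r = s \<or> children g r = {}")
  case True
  then show ?thesis by (auto simp: impact_exchange_def)
next
  case False
  then obtain i where "(r, i) \<in> parcs g" by (auto simp: children_def)
  with child_ratio_le_impact_exchange False kleene_star_nonneg show ?thesis
    by (meson divide_nonneg_nonneg order_trans)
qed

text \<open>
  A potential \<open>y\<close> of the impact exchange matrix makes every root \<open>r\<close> beat the other roots at the
  children of \<open>r\<close>, but it says nothing about the roots themselves.  Taking the max-linear
  closure \<open>x\<^sub>r = max\<^sub>v c\<^sup>*\<^sub>r\<^sub>v y\<^sub>v\<close> over the roots repairs this up to ties.  The strict inequalities survive:
  a contribution of \<open>v\<close> to \<open>x\<^sub>s\<close> that reaches the child \<open>i\<close> through \<open>s\<close> is at most the direct one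
  \<open>c\<^sup>*\<^sub>i\<^sub>v y\<^sub>v\<close>.  If \<open>v \<noteq> r\<close>, the potential bounds it; if \<open>v = r\<close>, then
  \<open>c\<^sup>*\<^sub>i\<^sub>s c\<^sup>*\<^sub>s\<^sub>r < c\<^sup>*\<^sub>i\<^sub>r\<close>, as equality would by the third condition of the theorem force the arc
  \<open>r \<rightarrow> s\<close> into the root \<open>s\<close>.
\<close>

lemma root_potential:
  obtains x where "\<And>r. r \<in> roots g \<Longrightarrow> x r > 0"
    and "\<And>r s. r \<in> roots g \<Longrightarrow> s \<in> roots g \<Longrightarrow> Cs $ r $ s * x s \<le> x r"
    and "\<And>r s i. r \<in> roots g \<Longrightarrow> s \<in> roots g \<Longrightarrow> r \<noteq> s \<Longrightarrow> (r, i) \<in> parcs g \<Longrightarrow>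
      Cs $ i $ s * x s < Cs $ i $ r * x r"
proof -
  obtain y where y_pos: "\<And>v. y v > 0"
    and y: "\<And>r s. r \<in> roots g \<Longrightarrow> s \<in> roots g \<Longrightarrow> impact_exchange Cs g r s * y s < y r"
    using potential_exists[of "roots g" "impact_exchange Cs g"] impact_exchange_nonneg
      closed_walk_product_less_1[of "roots g" "impact_exchange Cs g"] cycle_mean by auto metis
  define x where "x r = Max ((\<lambda>v. Cs $ r $ v * y v) ` roots g)" for r
  have x_ge: "Cs $ r $ v * y v \<le> x r" if "v \<in> roots g" for r v
    using that by (auto simp: x_def)
  have x_attained: "\<exists>v\<in>roots g. x r = Cs $ r $ v * y v" if "r \<in> roots g" for r
  proof -
    have "x r \<in> (\<lambda>v. Cs $ r $ v * y v) ` roots g"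
      unfolding x_def using that by (intro Max_in) auto
    then show ?thesis by blast
  qed
  have y_le_x: "y r \<le> x r" if "r \<in> roots g" for r
    using x_ge[OF that, of r] by (simp add: kleene_star_diag)
  show ?thesis
  proof (rule that[of x])
    show "x r > 0" if "r \<in> roots g" for r
      using y_le_x[OF that] y_pos[of r] by simp
    show "Cs $ r $ s * x s \<le> x r" if rs: "r \<in> roots g" "s \<in> roots g" for r s
    proof -
      obtain v where v: "v \<in> roots g" "x s = Cs $ s $ v * y v" using x_attained[OF rs(2)] by blast
      have "Cs $ r $ s * x s \<le> Cs $ r $ v * y v"
        using kleene_star_supermultiplicative[of r s v] y_pos[of v]
        by (simp add: v mult.assoc[symmetric] mult_right_mono)
      also have "\<dots> \<le> x r" by (rule x_ge[OF v(1)])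
      finally show ?thesis .
    qed
    fix r s i
    assume rs: "r \<in> roots g" "s \<in> roots g" "r \<noteq> s" and i: "(r, i) \<in> parcs g"
    have cir: "Cs $ i $ r > 0" "i \<noteq> r" using reachable[OF i] by auto
    obtain v where v: "v \<in> roots g" "x s = Cs $ s $ v * y v" using x_attained[OF rs(2)] by blast
    have "Cs $ i $ s * x s < Cs $ i $ r * y r"
    proof (cases "v = r")
      case True
      have "i \<noteq> s" using rs(2) i by (auto simp: roots_def)
      moreover have "(r, s) \<notin> parcs g" using rs(2) by (auto simp: roots_def)
      ultimately have "Cs $ i $ r \<noteq> Cs $ i $ s * Cs $ s $ r"
        using shared_path[of i r s] cir(2) rs(3) i by blast
      with kleene_star_supermultiplicative[of i s r] have "Cs $ i $ s * Cs $ s $ r < Cs $ i $ r"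
        by simp
      then show ?thesis using y_pos[of r] by (simp add: v True mult.assoc[symmetric])
    next
      case False
      have "Cs $ i $ s * x s \<le> Cs $ i $ v * y v"
        using kleene_star_supermultiplicative[of i s v] y_pos[of v]
        by (simp add: v mult.assoc[symmetric] mult_right_mono)
      also have "\<dots> = Cs $ i $ r * (Cs $ i $ v / Cs $ i $ r * y v)"
        using cir by simp
      also have "\<dots> \<le> Cs $ i $ r * (impact_exchange Cs g r v * y v)"
        using child_ratio_le_impact_exchange[OF i, of v] False cir y_pos[of v]
        by (intro mult_left_mono mult_right_mono) auto
      also have "\<dots> < Cs $ i $ r * y r"
        using y[OF rs(1) v(1)] cir by simp
      finally show ?thesis .
    qed
    also have "\<dots> \<le> Cs $ i $ r * x r" using y_le_x[OF rs(1)] cir by simp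
    finally show "Cs $ i $ s * x s < Cs $ i $ r * x r" .
  qed
qed

text \<open>
  The centre of the star that contains \<open>i\<close>, that is, the node whose innovation has to decide \<open>i\<close>.
\<close>

definition centre :: "'n \<Rightarrow> 'n" where
  "centre i = (if i \<in> roots g then i else THE j. (j, i) \<in> parcs g)"

lemma centre_root [simp]: "i \<in> roots g \<Longrightarrow> centre i = i"
  by (simp add: centre_def)

lemma centre_child:
  assumes "(j, i) \<in> parcs g"
  shows "centre i = j"
proof -
  have "i \<notin> roots g" using assms by (auto simp: roots_def)
  moreover have "(THE j. (j, i) \<in> parcs g) = j"
    using assms galaxyD(1)[OF galaxy_g] by blast
  ultimately show ?thesis by (simp add: centre_def)
qed

lemma centre_cases:
  obtains "i \<in> roots g" "centre i = i" | "(centre i, i) \<in> parcs g" "i \<notin> roots g" "centre i \<in> roots g"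
proof (cases "i \<in> roots g")
  case False
  then obtain j where "(j, i) \<in> parcs g" by (auto simp: roots_def verts_g)
  moreover from this have "j \<in> roots g"
    using galaxyD(2)[OF galaxy_g] by (auto simp: roots_def verts_g)
  ultimately show ?thesis using that(2) False by (simp add: centre_child)
qed (use that in simp)

lemma arc_iff_centre: "(j, i) \<in> parcs g \<longleftrightarrow> i \<noteq> j \<and> centre i = j"
  by (metis centre_cases centre_child reachable)

text \<open>
  Any strictly monotone height function on the reachability DAG would do; the number of ancestors
  (the node itself included) is one.
\<close>

definition depth :: "'n \<Rightarrow> nat" where
  "depth i = card {v. Cs $ i $ v > 0}"

lemma depth_less:
  assumes "Cs $ i $ j > 0" "i \<noteq> j"
  shows "depth j < depth i"
  unfolding depth_def
proof (rule psubset_card_mono)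
  have "Cs $ i $ v > 0" if "Cs $ j $ v > 0" for v
    using mult_pos_pos[OF assms(1) that] kleene_star_supermultiplicative[of i j v] by linarith
  moreover have "Cs $ j $ i = 0" by (rule kleene_star_antisym[OF assms(2,1)])
  moreover have "Cs $ i $ i > 0" by (simp add: kleene_star_diag)
  ultimately show "{v. Cs $ j $ v > 0} \<subset> {v. Cs $ i $ v > 0}"
    by (metis (mono_tags, lifting) mem_Collect_eq order_less_irrefl psubsetI subsetI)
qed simp

text \<open>
  Perturb the root values \<open>x\<close> by the factors \<open>(1 + d)^depth\<close> and give every other node the value \<open>d\<close>.
  For small \<open>d > 0\<close> the inequalities that are strict in the limit persist.  In the
  limit, strictness can fail only between two roots of which one reaches the other, and there the larger
  exponent at the descendant breaks the tie in its favour.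
\<close>

lemma strict_realization:
  obtains z where "\<And>i. z i > 0"
    and "\<And>i k. k \<noteq> centre i \<Longrightarrow> Cs $ i $ k * z k < Cs $ i $ centre i * z (centre i)"
proof -
  obtain x where x_pos: "\<And>r. r \<in> roots g \<Longrightarrow> x r > 0"
    and x_le: "\<And>r s. r \<in> roots g \<Longrightarrow> s \<in> roots g \<Longrightarrow> Cs $ r $ s * x s \<le> x r"
    and x_less: "\<And>r s i. r \<in> roots g \<Longrightarrow> s \<in> roots g \<Longrightarrow> r \<noteq> s \<Longrightarrow> (r, i) \<in> parcs g \<Longrightarrow>
      Cs $ i $ s * x s < Cs $ i $ r * x r"
    using root_potential by blast
  define z where "z d i = (if i \<in> roots g then x i * (1 + d) ^ depth i else d)" for d i
  \<comment> \<open>The limit of \<open>z d\<close> as \<open>d\<close> tends to 0.\<close>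
  define z0 where "z0 i = (if i \<in> roots g then x i else 0)" for i
  have z_lim: "((\<lambda>d. z d i) \<longlongrightarrow> z0 i) (at_right 0)" for i
  proof -
    have "((\<lambda>d. x i * (1 + d) ^ depth i) \<longlongrightarrow> x i * (1 + 0) ^ depth i) (at_right 0)"
      by (intro tendsto_intros)
    moreover have "((\<lambda>d::real. d) \<longlongrightarrow> 0) (at_right 0)" by (rule tendsto_ident_at)
    ultimately show ?thesis by (auto simp: z_def z0_def)
  qed
  have centre_pos: "centre i \<in> roots g" "Cs $ i $ centre i > 0" for i
    by (cases i rule: centre_cases; use reachable kleene_star_diag[of i] in force)+
  have pos: "\<forall>\<^sub>F d :: real in at_right 0. d > 0" by (rule eventually_at_right_less)
  have ev: "\<forall>\<^sub>F d in at_right 0. Cs $ i $ k * z d k < Cs $ i $ centre i * z d (centre i)"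
    if k: "k \<noteq> centre i" for i k
  proof (cases "k \<in> roots g \<and> i \<in> roots g")
    case True
    then have i: "centre i = i" by simp
    show ?thesis
      using pos
    proof eventually_elim
      case (elim d)
      show ?case
      proof (cases "Cs $ i $ k = 0")
        case True
        then show ?thesis
          using elim x_pos centre_pos[of i] by (auto simp: z_def)
      next
        case False
        then have "Cs $ i $ k > 0" using kleene_star_nonneg[of i k] by simp
        then have "depth k < depth i" using k i by (intro depth_less) auto
        have "Cs $ i $ k * x k * (1 + d) ^ depth k \<le> x i * (1 + d) ^ depth k"
          using x_le[of i k] True elim by (intro mult_right_mono) auto
        also have "\<dots> < x i * (1 + d) ^ depth i"
          using \<open>depth k < depth i\<close> elim x_pos[of i] True by (simp add: power_strict_increasing)
        finally show ?thesis using True by (simp add: i z_def kleene_star_diag mult.assoc)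
      qed
    qed
  next
    case False
    have "Cs $ i $ k * z0 k < Cs $ i $ centre i * z0 (centre i)"
    proof (cases "k \<in> roots g")
      case True
      with False have "i \<notin> roots g" by simp
      then have "(centre i, i) \<in> parcs g" by (cases i rule: centre_cases) auto
      with True show ?thesis using x_less[OF centre_pos(1)] k centre_pos(1) by (auto simp: z0_def)
    next
      case False
      then show ?thesis using centre_pos x_pos by (simp add: z0_def)
    qed
    then show ?thesis
      by (rule eventually_less_if_limits_less[rotated 2]) (intro tendsto_intros z_lim)+
  qed
  have "\<forall>\<^sub>F d in at_right 0. k \<noteq> centre i \<longrightarrow>
      Cs $ i $ k * z d k < Cs $ i $ centre i * z d (centre i)" for i k
    using ev[of k i] by (cases "k = centre i") simp_all
  then have "\<forall>\<^sub>F d in at_right 0. \<forall>i k. k \<noteq> centre i \<longrightarrow>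
      Cs $ i $ k * z d k < Cs $ i $ centre i * z d (centre i)"
    by (intro eventually_all_finite)
  with pos have "\<forall>\<^sub>F d in at_right 0. d > 0 \<and> (\<forall>i k. k \<noteq> centre i \<longrightarrow>
      Cs $ i $ k * z d k < Cs $ i $ centre i * z d (centre i))"
    by (rule eventually_conj)
  then obtain d where "d > 0" and d: "\<forall>i k. k \<noteq> centre i \<longrightarrow>
      Cs $ i $ k * z d k < Cs $ i $ centre i * z d (centre i)"
    using eventually_happens'[OF trivial_limit_at_right_real] by blast
  moreover have "z d i > 0" for i using x_pos \<open>d > 0\<close> by (simp add: z_def)
  ultimately show ?thesis using that[of "z d"] by blast
qed

text \<open>
  Strict inequalities are stable, so the graph is realized on a whole box around \<open>z\<close>.  In the box each
  term is largest at the upper and smallest at the lower end of the interval of its variable.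
\<close>

lemma realization_box:
  obtains z e where "\<And>i. z i > 0" "e > 0"
    and "\<And>z'. (\<And>i. \<bar>z' i - z i\<bar> < e) \<Longrightarrow> impact_arcs z' = parcs g"
proof -
  obtain z where z_pos: "\<And>i. z i > 0"
    and z: "\<And>i k. k \<noteq> centre i \<Longrightarrow> Cs $ i $ k * z k < Cs $ i $ centre i * z (centre i)"
    using strict_realization by blast
  have ev: "\<forall>\<^sub>F e in at_right 0.
      Cs $ i $ k * (z k + e) < Cs $ i $ centre i * (z (centre i) - e)"
    if "k \<noteq> centre i" for i k
  proof (rule eventually_less_if_limits_less)
    show "((\<lambda>e. Cs $ i $ k * (z k + e)) \<longlongrightarrow> Cs $ i $ k * (z k + 0)) (at_right 0)"
      and "((\<lambda>e. Cs $ i $ centre i * (z (centre i) - e)) \<longlongrightarrow> Cs $ i $ centre i * (z (centre i) - 0))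
        (at_right 0)"
      by (intro tendsto_intros)+
  qed (use z[OF that] in simp)
  have "\<forall>\<^sub>F e in at_right 0. k \<noteq> centre i \<longrightarrow>
      Cs $ i $ k * (z k + e) < Cs $ i $ centre i * (z (centre i) - e)" for i k
    using ev[of k i] by (cases "k = centre i") simp_all
  then have "\<forall>\<^sub>F e in at_right 0. \<forall>i k. k \<noteq> centre i \<longrightarrow>
      Cs $ i $ k * (z k + e) < Cs $ i $ centre i * (z (centre i) - e)"
    by (intro eventually_all_finite)
  with eventually_at_right_less have "\<forall>\<^sub>F e :: real in at_right 0. e > 0 \<and> (\<forall>i k. k \<noteq> centre i \<longrightarrow>
      Cs $ i $ k * (z k + e) < Cs $ i $ centre i * (z (centre i) - e))"
    by (rule eventually_conj)
  then obtain e :: real where "e > 0"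
    and e: "\<And>i k. k \<noteq> centre i \<Longrightarrow>
      Cs $ i $ k * (z k + e) < Cs $ i $ centre i * (z (centre i) - e)"
    using eventually_happens'[OF trivial_limit_at_right_real] by blast
  have "impact_arcs z' = parcs g" if z': "\<And>i. \<bar>z' i - z i\<bar> < e" for z'
  proof -
    have less: "Cs $ i $ k * z' k < Cs $ i $ centre i * z' (centre i)" if "k \<noteq> centre i" for i k
    proof -
      have "Cs $ i $ k * z' k \<le> Cs $ i $ k * (z k + e)"
        using z'[of k] kleene_star_nonneg[of i k] by (intro mult_left_mono) auto
      also have "\<dots> < Cs $ i $ centre i * (z (centre i) - e)" by (rule e[OF that])
      also have "\<dots> \<le> Cs $ i $ centre i * z' (centre i)"
        using z'[of "centre i"] kleene_star_nonneg[of i "centre i"]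
        by (intro mult_left_mono) auto
      finally show ?thesis .
    qed
    have "(\<forall>k. Cs $ i $ k * z' k \<le> Cs $ i $ j * z' j) \<longleftrightarrow> centre i = j" for i j
      using less by (metis less_le_not_le order_refl)
    then have "(j, i) \<in> impact_arcs z' \<longleftrightarrow> (j, i) \<in> parcs g" for i j
      by (auto simp: impact_arcs_def arc_iff_centre)
    then show ?thesis by auto
  qed
  with z_pos \<open>e > 0\<close> show ?thesis using that by blast
qed

end
end

section \<open>The probability of an impact graph\<close>

lemma positive_part_in_pos_borel: "A \<in> sets borel \<Longrightarrow> A \<inter> {0<..} \<in> sets pos_borel"
  by (simp add: sets_restrict_space_iff)

sublocale max_linear_bayesian_network \<subseteq> weighted_dag D C
  by unfold_locales (fact verts_D dag_D C_nonneg C_pos_iff)+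

context max_linear_bayesian_network
begin

lemma innovation_rv: "random_variable pos_borel (Z i)"
  using indep_Z by (simp add: indep_vars_def)

lemma innovation_measurable [measurable]: "Z i \<in> borel_measurable M"
  using innovation_rv by (simp add: measurable_restrict_space2_iff)

lemma innovation_pos: "\<omega> \<in> space M \<Longrightarrow> Z i \<omega> > 0"
  using innovation_rv[of i] by (auto simp: measurable_restrict_space2_iff)

lemma impact_graph_eq_iff:
  assumes "\<omega> \<in> space M" "pverts g = UNIV"
  shows "impact_graph Cs Z X \<omega> = g \<longleftrightarrow> parcs g = impact_arcs (\<lambda>i. Z i \<omega>)"
proof -
  note sol = max_linear_solution[of "\<lambda>i. Z i \<omega>" "\<lambda>i. X i \<omega>",
      OF innovation_pos[OF assms(1)] X_eq[OF assms(1)]]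
  have "X i \<omega> = Cs $ i $ j * Z j \<omega> \<longleftrightarrow> (\<forall>k. Cs $ i $ k * Z k \<omega> \<le> Cs $ i $ j * Z j \<omega>)" for i j
  proof
    assume "\<forall>k. Cs $ i $ k * Z k \<omega> \<le> Cs $ i $ j * Z j \<omega>"
    then have "X i \<omega> \<le> Cs $ i $ j * Z j \<omega>" using sol(2)[of i] by auto
    then show "X i \<omega> = Cs $ i $ j * Z j \<omega>" using sol(1)[of i j] by (rule antisym)
  next
    assume eq: "X i \<omega> = Cs $ i $ j * Z j \<omega>"
    show "\<forall>k. Cs $ i $ k * Z k \<omega> \<le> Cs $ i $ j * Z j \<omega>"
      unfolding eq[symmetric] using sol(1) by blast
  qed
  then have "parcs (impact_graph Cs Z X \<omega>) = impact_arcs (\<lambda>i. Z i \<omega>)"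
    by (simp add: impact_graph_def impact_arcs_def)
  moreover have "pverts (impact_graph Cs Z X \<omega>) = UNIV"
    by (simp add: impact_graph_def)
  ultimately show ?thesis using assms(2) by (auto intro: pair_pre_digraph.equality)
qed

lemma innovations_pairwise_indep:
  assumes "j \<noteq> k"
  shows "indep_var pos_borel (Z j) pos_borel (Z k)"
proof -
  have "indep_var (PiM {j} (\<lambda>_. pos_borel)) (\<lambda>\<omega>. restrict (\<lambda>i. Z i \<omega>) {j})
      (PiM {k} (\<lambda>_. pos_borel)) (\<lambda>\<omega>. restrict (\<lambda>i. Z i \<omega>) {k})"
    using assms by (intro indep_var_restrict[OF indep_Z]) auto
  from indep_var_compose[OF this measurable_component_singleton[of j] measurable_component_singleton[of k]]
  show ?thesis by (simp add: comp_def)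
qed

text \<open>
  The pair \<open>(Z\<^sub>j, Z\<^sub>k)\<close> has a product distribution, and by Fubini such a distribution does not charge a
  line through the origin: every section of the line is a point, which has measure zero.
\<close>

lemma AE_no_tie:
  assumes "j \<noteq> k" "a > 0" "b > 0"
  shows "AE \<omega> in M. a * Z j \<omega> \<noteq> b * Z k \<omega>"
proof -
  let ?P = "distr M pos_borel (Z j)" and ?Q = "distr M pos_borel (Z k)"
  interpret P: prob_space ?P by (rule prob_space_distr[OF innovation_rv])
  interpret Q: prob_space ?Q by (rule prob_space_distr[OF innovation_rv])
  interpret PQ: pair_sigma_finite ?P ?Q ..
  have null: "AE y in ?Q. a * x \<noteq> b * y" for x
  proof (rule AE_I')
    have "{y \<in> space ?Q. \<not> a * x \<noteq> b * y} \<subseteq> {a * x / b} \<inter> {0<..}"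
      using assms by (auto simp: field_simps)
    moreover have "{a * x / b} \<inter> {0<..} \<in> null_sets ?Q"
    proof -
      have "{a * x / b} \<inter> {0<..} \<in> sets ?Q"
        by (simp add: positive_part_in_pos_borel)
      moreover have "emeasure ?Q ({a * x / b} \<inter> {0<..}) = 0"
        using atom_free_Z[of k "a * x / b"]
        by (cases "a * x / b > 0") (auto simp: Q.emeasure_eq_measure)
      ultimately show ?thesis by (simp add: null_sets_def)
    qed
    ultimately show "{y \<in> space ?Q. \<not> a * x \<noteq> b * y} \<subseteq> {a * x / b} \<inter> {0<..}"
      "{a * x / b} \<inter> {0<..} \<in> null_sets ?Q" by auto
  qed
  have meas: "Measurable.pred (pos_borel \<Otimes>\<^sub>M pos_borel) (\<lambda>p. a * fst p \<noteq> b * snd p)"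
  proof -
    have [measurable]: "(\<lambda>x. x) \<in> measurable pos_borel borel"
      by (rule measurable_restrict_space1) simp
    have [measurable]: "(\<lambda>p. fst p) \<in> borel_measurable (pos_borel \<Otimes>\<^sub>M pos_borel)"
      "(\<lambda>p. snd p) \<in> borel_measurable (pos_borel \<Otimes>\<^sub>M pos_borel)"
      by measurable
    show ?thesis by measurable
  qed
  have "AE p in ?P \<Otimes>\<^sub>M ?Q. a * fst p \<noteq> b * snd p"
    using meas null by (intro PQ.AE_pair_measure) (auto simp: pred_def space_pair_measure)
  moreover have eq: "?P \<Otimes>\<^sub>M ?Q = distr M (pos_borel \<Otimes>\<^sub>M pos_borel) (\<lambda>\<omega>. (Z j \<omega>, Z k \<omega>))"
    using innovations_pairwise_indep[OF assms(1)] by (simp add: indep_var_distribution_eq)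
  moreover have "(\<lambda>\<omega>. (Z j \<omega>, Z k \<omega>)) \<in> measurable M (pos_borel \<Otimes>\<^sub>M pos_borel)"
    using innovation_rv by (intro measurable_Pair)
  ultimately show ?thesis
    unfolding eq using meas AE_distr_iff[of "\<lambda>\<omega>. (Z j \<omega>, Z k \<omega>)" M "pos_borel \<Otimes>\<^sub>M pos_borel"
        "\<lambda>p. a * fst p \<noteq> b * snd p"] by (simp add: pred_def)
qed

lemma AE_tie_free: "AE \<omega> in M. tie_free (\<lambda>i. Z i \<omega>)"
  unfolding tie_free_def by (intro AE_all_countable[THEN iffD2] allI AE_impI AE_no_tie)

text \<open>
  By independence the probability of a box is a product, and each factor is positive because every
  point of \<open>(0, \<infinity>)\<close> lies in the support.
\<close>

lemma innovation_box_prob_pos: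
  assumes "\<And>i. z i > 0" "e > 0"
  shows "measure M {\<omega> \<in> space M. \<forall>i. \<bar>Z i \<omega> - z i\<bar> < e} > 0"
proof -
  define B where "B i = ball (z i) e \<inter> {0<..}" for i
  have B: "B i \<in> sets pos_borel" for i
    by (simp add: B_def positive_part_in_pos_borel)
  have "prob (Z i -` B i \<inter> space M) > 0" for i
  proof -
    have "z i \<in> msupport (distr M pos_borel (Z i))" using assms by (simp add: support_Z)
    then have "emeasure (distr M pos_borel (Z i)) (B i) > 0"
      using assms by (auto simp: msupport_def B_def)
    then show ?thesis
      using B by (simp add: emeasure_distr innovation_rv emeasure_eq_measure)
  qed
  then have "0 < (\<Prod>i\<in>UNIV. prob (Z i -` B i \<inter> space M))"
    by (intro prod_pos) auto
  also have "\<dots> = prob (\<Inter>i\<in>UNIV. Z i -` B i \<inter> space M)"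
    using indep_varsD_finite[OF indep_Z, of B] B by simp
  also have "(\<Inter>i\<in>UNIV. Z i -` B i \<inter> space M) = {\<omega> \<in> space M. \<forall>i. \<bar>Z i \<omega> - z i\<bar> < e}"
    using innovation_pos by (auto simp: B_def dist_real_def abs_minus_commute)
  finally show ?thesis .
qed

text \<open>
  Probabilities of sets that are not measurable are 0 by convention, so lower bounds for the
  probability of the event rest on this.
\<close>

lemma impact_event_measurable:
  assumes "pverts g = UNIV"
  shows "{\<omega> \<in> space M. impact_graph Cs Z X \<omega> = g} \<in> events"
proof -
  have "impact_graph Cs Z X \<omega> = g \<longleftrightarrow> (\<forall>i j. (j, i) \<in> parcs g \<longleftrightarrow>
      i \<noteq> j \<and> (\<forall>k. Cs $ i $ k * Z k \<omega> \<le> Cs $ i $ j * Z j \<omega>))" if "\<omega> \<in> space M" for \<omega>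
    unfolding impact_graph_eq_iff[OF that assms] by (auto simp: impact_arcs_def set_eq_iff)
  then have "{\<omega> \<in> space M. impact_graph Cs Z X \<omega> = g} =
      {\<omega> \<in> space M. \<forall>i j. (j, i) \<in> parcs g \<longleftrightarrow>
         i \<noteq> j \<and> (\<forall>k. Cs $ i $ k * Z k \<omega> \<le> Cs $ i $ j * Z j \<omega>)}"
    by blast
  also have "\<dots> \<in> events" by measurable
  finally show ?thesis .
qed

text \<open>
  An event of positive probability is not contained in the null set where ties occur.
\<close>

lemma impact_graphs_witness:
  assumes "g \<in> impact_graphs M Cs Z X" "pverts g = UNIV"
  obtains z where "\<And>i. z i > 0" "tie_free z" "parcs g = impact_arcs z"
proof -
  have "\<exists>\<omega>\<in>space M. impact_graph Cs Z X \<omega> = g \<and> tie_free (\<lambda>i. Z i \<omega>)"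
  proof (rule ccontr)
    assume none: "\<not> ?thesis"
    have "AE \<omega> in M. impact_graph Cs Z X \<omega> \<noteq> g"
      using AE_tie_free AE_space by eventually_elim (use none in auto)
    then have "prob {\<omega> \<in> space M. impact_graph Cs Z X \<omega> = g} = 0"
      using impact_event_measurable[OF assms(2)] by (simp add: prob_eq_0)
    with assms(1) show False by (simp add: impact_graphs_def)
  qed
  then obtain \<omega> where "\<omega> \<in> space M" "impact_graph Cs Z X \<omega> = g" "tie_free (\<lambda>i. Z i \<omega>)"
    by blast
  then show ?thesis
    using that[of "\<lambda>i. Z i \<omega>"] innovation_pos impact_graph_eq_iff[of \<omega> g] assms(2) by simp
qed

lemma impact_graphs_if_box:
  assumes "pverts g = UNIV" "\<And>i. z i > 0" "e > 0"
    and box: "\<And>z'. (\<And>i. \<bar>z' i - z i\<bar> < e) \<Longrightarrow> impact_arcs z' = parcs g"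
  shows "g \<in> impact_graphs M Cs Z X"
proof -
  have "0 < prob {\<omega> \<in> space M. \<forall>i. \<bar>Z i \<omega> - z i\<bar> < e}"
    using assms by (intro innovation_box_prob_pos)
  also have "\<dots> \<le> prob {\<omega> \<in> space M. impact_graph Cs Z X \<omega> = g}"
    using box impact_graph_eq_iff[OF _ assms(1)]
    by (intro finite_measure_mono impact_event_measurable assms(1)) auto
  finally show ?thesis by (simp add: impact_graphs_def)
qed

end

section \<open>The characterization\<close>

lemma subgraph_reachability_dag_iff:
  assumes "pverts g = UNIV"
  shows "subgraph (with_proj g) (with_proj (reachability_dag A)) \<longleftrightarrow>
    (\<forall>i j. (j, i) \<in> parcs g \<longrightarrow> i \<noteq> j \<and> A $ i $ j > 0)"
proof -
  have wf: "wf_digraph (with_proj h)" if "pverts h = UNIV" for h :: "'n pair_pre_digraph"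
    using that by unfold_locales auto
  show ?thesis
    using wf[OF assms] wf[of "reachability_dag A"] assms
    by (auto simp: subgraph_def compatible_def reachability_dag_def)
qed

theorem theorem3p3:
  fixes M :: "'w measure"
    and D g :: "'n::finite pair_pre_digraph"
    and C Cs :: "real^'n^'n"
    and Z X :: "'n \<Rightarrow> 'w \<Rightarrow> real"
  assumes "max_linear_bayesian_network M D C Z X"
    and "Cs = kleene_star D C"
    and "pverts g = UNIV"
  shows "g \<in> impact_graphs M Cs Z X \<longleftrightarrow>
      subgraph (with_proj g) (with_proj (reachability_dag Cs))
    \<and> galaxy g
    \<and> (\<forall>i j k. i \<noteq> j \<and> i \<noteq> k \<and> j \<noteq> k \<and> (j, i) \<in> parcs g \<and> Cs $ i $ j = Cs $ i $ k * Cs $ k $ j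
          \<longrightarrow> (k, i) \<notin> parcs g \<and> (j, k) \<in> parcs g)
    \<and> max_cycle_mean (roots g) (impact_exchange Cs g) < 1"
    (is "_ \<longleftrightarrow> ?a \<and> ?b \<and> ?c \<and> ?d")
proof -
  interpret max_linear_bayesian_network M D C Z X by (rule assms(1))
  note verts = assms(3)
  have a_iff: "?a \<longleftrightarrow> (\<forall>i j. (j, i) \<in> parcs g \<longrightarrow> i \<noteq> j \<and> Cs $ i $ j > 0)"
    by (rule subgraph_reachability_dag_iff[OF verts])
  show ?thesis
  proof (intro iffI conjI)
    assume "g \<in> impact_graphs M Cs Z X"
    then obtain z where z: "\<And>i. z i > 0" "tie_free z" "parcs g = impact_arcs z"
      unfolding assms(2) by (rule impact_graphs_witness[OF _ verts]) (use that in blast)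
    show ?a
      unfolding a_iff unfolding assms(2) z(3) using impact_arc_pos[of z, OF z(1)] by blast
    show ?b by (rule impact_galaxy[OF z(1,2) verts z(3)])
    show ?c
      unfolding assms(2)
    proof (intro allI impI, elim conjE)
      fix i j k
      assume "j \<noteq> k" "(j, i) \<in> parcs g"
        "kleene_star D C $ i $ j = kleene_star D C $ i $ k * kleene_star D C $ k $ j"
      then show "(k, i) \<notin> parcs g \<and> (j, k) \<in> parcs g"
        using impact_shared_path[OF z(1,2) verts z(3), of j i k] by blast
    qed
    show ?d unfolding assms(2) by (rule impact_cycle_mean[OF z(1,2) verts z(3)])
  next
    assume "?a \<and> ?b \<and> ?c \<and> ?d"
    then have a: ?a and b: ?b and c: ?c and d: ?d by blast+
    show "g \<in> impact_graphs M Cs Z X"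
      unfolding assms(2)
    proof (rule realization_box[of g])
      show "i \<noteq> j \<and> kleene_star D C $ i $ j > 0" if "(j, i) \<in> parcs g" for i j
        using a[unfolded a_iff, unfolded assms(2)] that by blast
      show "(k, i) \<notin> parcs g \<and> (j, k) \<in> parcs g"
        if "i \<noteq> j" "i \<noteq> k" "j \<noteq> k" "(j, i) \<in> parcs g"
          "kleene_star D C $ i $ j = kleene_star D C $ i $ k * kleene_star D C $ k $ j" for i j k
        using c[unfolded assms(2)] that by blast
      show "max_cycle_mean (roots g) (impact_exchange (kleene_star D C) g) < 1"
        using d[unfolded assms(2)] .
      fix z :: "'n \<Rightarrow> real" and e :: real
      assume "\<And>i. z i > 0" "e > 0"
        and "\<And>z'. (\<And>i. \<bar>z' i - z i\<bar> < e) \<Longrightarrow> impact_arcs z' = parcs g"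
      then show "g \<in> impact_graphs M (kleene_star D C) Z X"
        by (rule impact_graphs_if_box[OF verts])
    qed (rule verts b)+
  qed
qed

end
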